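(* For every positive integer $N$ and every permutation group $G\le S_N$, the semifield of $G$-invariant tropical rational functions on $\mathbb{R}^N$ is generated by finitely many $G$-invariant tropical polynomials of degree at most $\max\{N,\binom N2\}$.
   Context: $G\le S_N$ acts on $\mathbb{R}^N$ by coordinate permutations. A tropical polynomial on $\mathbb{R}^m$ is a finite maximum $\max_j\ell_j$ of functions $\ell_j(z)=\gamma_j+\langle a_j,z\rangle$ with $\gamma_j\in\mathbb{R}$, $a_j\in\mathbb{Z}_{\ge0}^m$; its degree is the smallest value, over all such representations of the function, of $\max_j\|a_j\|_1$. A tropical rational function is a difference of two tropical polynomials, regarded as a function. These form a semifield under $\max$ (addition), $+$ (multiplication), $-$ (division). Invariants $f_1,\dots,f_k$ generate the semifield of $G$-invariant tropical rational functions if every $G$-invariant tropical rational $f$ on $\mathbb{R}^N$ equals $g(f_1,\dots,f_k)$ for some tropical rational $g$ on $\mathbb{R}^k$. *)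

theory Defs
  imports Complex_Main "HOL-Algebra.Sym_Groups"
begin

text \<open>
  A point of \<open>\<real>\<^sup>m\<close> is a function \<^typ>\<open>nat \<Rightarrow> real\<close> of which only the coordinates \<open>1, \<dots>, m\<close> matter
  (indexed from 1 to match \<^const>\<open>sym_group\<close>).  Functions on \<open>\<real>\<^sup>m\<close> are functions on
  \<^typ>\<open>nat \<Rightarrow> real\<close> that depend on these coordinates only; for such functions equality on
  \<^typ>\<open>nat \<Rightarrow> real\<close> is the same as equality on \<open>\<real>\<^sup>m\<close>.

  A pair \<open>(\<gamma>, a)\<close> stands for the affine function \<open>\<gamma> + \<langle>a, z\<rangle>\<close> on \<open>\<real>\<^sup>m\<close>.
\<close>

definition trop_monomial :: "nat \<Rightarrow> real \<times> (nat \<Rightarrow> nat) \<Rightarrow> (nat \<Rightarrow> real) \<Rightarrow> real" where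
  "trop_monomial m t z = fst t + (\<Sum>i=1..m. real (snd t i) * z i)"

definition trop_represents ::
  "nat \<Rightarrow> (real \<times> (nat \<Rightarrow> nat)) set \<Rightarrow> ((nat \<Rightarrow> real) \<Rightarrow> real) \<Rightarrow> bool" where
  "trop_represents m T f \<longleftrightarrow>
     finite T \<and> T \<noteq> {} \<and> (\<forall>z. f z = Max ((\<lambda>t. trop_monomial m t z) ` T))"

definition trop_polynomial :: "nat \<Rightarrow> ((nat \<Rightarrow> real) \<Rightarrow> real) \<Rightarrow> bool" where
  "trop_polynomial m f \<longleftrightarrow> (\<exists>T. trop_represents m T f)"

text \<open>Only meaningful for tropical polynomials \<open>f\<close>.\<close>

definition trop_degree :: "nat \<Rightarrow> ((nat \<Rightarrow> real) \<Rightarrow> real) \<Rightarrow> nat" where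
  "trop_degree m f =
     (LEAST d. \<exists>T. trop_represents m T f \<and> d = Max ((\<lambda>t. \<Sum>i=1..m. snd t i) ` T))"

definition trop_rational :: "nat \<Rightarrow> ((nat \<Rightarrow> real) \<Rightarrow> real) \<Rightarrow> bool" where
  "trop_rational m f \<longleftrightarrow>
     (\<exists>p q. trop_polynomial m p \<and> trop_polynomial m q \<and> (\<forall>z. f z = p z - q z))"

text \<open>
  \<open>x \<circ> \<sigma>\<close> permutes the coordinates of \<open>x\<close>.  The left action would be by \<open>x \<circ> \<sigma>\<inverse>\<close>, which gives the
  same invariants when \<open>G\<close> is a group.
\<close>

definition perm_invariant :: "(nat \<Rightarrow> nat) set \<Rightarrow> ((nat \<Rightarrow> real) \<Rightarrow> real) \<Rightarrow> bool" where
  "perm_invariant G f \<longleftrightarrow> (\<forall>\<sigma>\<in>G. \<forall>x. f (x \<circ> \<sigma>) = f x)"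

text \<open>
  The generators are \<open>fs 1, \<dots>, fs k\<close>.  The tropical rational function \<open>g\<close> ignores all coordinates
  outside \<open>{1..k}\<close>, so the remaining values of \<open>fs\<close> are irrelevant.
\<close>

definition generates_invariant_semifield ::
  "nat \<Rightarrow> (nat \<Rightarrow> nat) set \<Rightarrow> nat \<Rightarrow> (nat \<Rightarrow> (nat \<Rightarrow> real) \<Rightarrow> real) \<Rightarrow> bool" where
  "generates_invariant_semifield N G k fs \<longleftrightarrow>
     (\<forall>f. trop_rational N f \<and> perm_invariant G f \<longrightarrow>
        (\<exists>g. trop_rational k g \<and> (\<forall>x. f x = g (\<lambda>i. fs i x))))"

lemma trop_represents_cong:
  assumes "trop_represents m T f" and "\<And>i. 1 \<le> i \<Longrightarrow> i \<le> m \<Longrightarrow> x i = y i"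
  shows "f x = f y"
proof -
  have "trop_monomial m t x = trop_monomial m t y" for t
    using assms(2) by (simp add: trop_monomial_def)
  then show ?thesis
    using assms(1) by (simp add: trop_represents_def)
qed

lemma trop_rational_cong:
  assumes "trop_rational m f" and "\<And>i. 1 \<le> i \<Longrightarrow> i \<le> m \<Longrightarrow> x i = y i"
  shows "f x = f y"
  using assms trop_represents_cong[of m _ _ x y]
  unfolding trop_rational_def trop_polynomial_def by metis

end

theory Submission
  imports Defs
begin

text \<open>
  Two kinds of generators suffice: the tropical elementary symmetric polynomials \<open>e(1), \<dots>, e(N)\<close>, where
  \<open>e(k)\<close> is the sum of the \<open>k\<close> largest coordinates, and for every permutation \<open>w\<close> the staircase
  maximum \<open>f\<^sub>w(x) = max {\<Sum>\<^sub>i (N - i) x(\<sigma>(w i)) | \<sigma> \<in> G}\<close>.  Their degrees are at most \<open>N\<close> and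
  \<open>0 + 1 + \<dots> + (N - 1)\<close>, the binomial coefficient \<open>N\<close> over 2.

  The \<open>e(k)\<close> determine the decreasing rearrangement \<open>t\<close> of \<open>x\<close>, since \<open>t(k) = e(k) - e(k - 1)\<close>.  What is left
  to know is the orbit of \<open>x\<close> under \<open>G\<close> among the rearrangements \<open>t \<circ> w\<inverse>\<close>.  By the rearrangement
  inequality the gap \<open>d\<^sub>w = (e(1) + \<dots> + e(N - 1)) - f\<^sub>w\<close> is nonnegative, and it vanishes exactly when
  \<open>t \<circ> w\<inverse>\<close> lies in the orbit of \<open>x\<close>.  The essential point is a quantitative form
  (\<open>staircase_gap\<close>): \<open>t \<circ> w\<inverse>\<close> is within sup distance \<open>d\<^sub>w\<close> of the orbit of \<open>x\<close>.

  An invariant tropical rational function \<open>f\<close> is Lipschitz for the sup norm with some natural constant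
  \<open>L\<close>, hence \<open>f (t \<circ> w\<inverse>) - L d\<^sub>w \<le> f x\<close> for all \<open>w\<close>, with equality if \<open>w\<close> sorts \<open>x\<close>.  Therefore \<open>f x\<close> is
  the maximum over \<open>w\<close> of these expressions (\<open>invariant_reconstruction\<close>).  They are tropical
  rational in the generators because tropical rational functions are closed under substitution and
  because \<open>L\<close> is an integer.
\<close>

section \<open>Closure properties of tropical rational functions\<close>

lemma trop_monomial_add:
  "trop_monomial m (c + d, \<lambda>i. a i + b i) z = trop_monomial m (c, a) z + trop_monomial m (d, b) z"
  by (simp add: trop_monomial_def distrib_right sum.distrib)

lemma trop_polynomial_const: "trop_polynomial m (\<lambda>z. c)"
  unfolding trop_polynomial_def trop_represents_def
  by (rule exI[of _ "{(c, \<lambda>_. 0)}"]) (simp add: trop_monomial_def)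

lemma trop_polynomial_coordinate:
  assumes "i \<in> {1..m}"
  shows "trop_polynomial m (\<lambda>z. z i)"
proof -
  have "(\<Sum>j = 1..m. real (if j = i then 1 else 0) * z j) = z i" for z :: "nat \<Rightarrow> real"
    using assms by (simp add: if_distrib[of real] if_distrib[of "\<lambda>a. a * _"] cong: if_cong)
  then show ?thesis
    unfolding trop_polynomial_def trop_represents_def
    by (intro exI[of _ "{(0, \<lambda>j. if j = i then 1 else 0)}"]) (simp add: trop_monomial_def)
qed

lemma trop_polynomial_max:
  assumes "trop_polynomial m p" and "trop_polynomial m q"
  shows "trop_polynomial m (\<lambda>z. max (p z) (q z))"
proof -
  obtain S T where "trop_represents m S p" and "trop_represents m T q"
    using assms by (auto simp: trop_polynomial_def)
  then have "trop_represents m (S \<union> T) (\<lambda>z. max (p z) (q z))"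
    by (simp add: trop_represents_def image_Un Max_Un)
  then show ?thesis
    by (auto simp: trop_polynomial_def)
qed

lemma trop_polynomial_add:
  assumes "trop_polynomial m p" and "trop_polynomial m q"
  shows "trop_polynomial m (\<lambda>z. p z + q z)"
proof -
  obtain S T where S: "trop_represents m S p" and T: "trop_represents m T q"
    using assms by (auto simp: trop_polynomial_def)
  define R where "R = (\<lambda>((c, a), (d, b)). (c + d, \<lambda>i. a i + b i)) ` (S \<times> T)"
  have fin: "finite S" "finite T" "S \<noteq> {}" "T \<noteq> {}"
    using S T by (auto simp: trop_represents_def)
  have "p z + q z = Max ((\<lambda>r. trop_monomial m r z) ` R)" for z
  proof (rule sym, rule Max_eqI)
    show "finite ((\<lambda>r. trop_monomial m r z) ` R)"
      using fin by (simp add: R_def)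
    fix y assume "y \<in> (\<lambda>r. trop_monomial m r z) ` R"
    then obtain s t where "s \<in> S" "t \<in> T" "y = trop_monomial m s z + trop_monomial m t z"
      by (auto simp: R_def trop_monomial_add)
    then show "y \<le> p z + q z"
      using S T fin by (auto simp: trop_represents_def intro!: add_mono Max_ge)
  next
    have "p z \<in> (\<lambda>t. trop_monomial m t z) ` S" "q z \<in> (\<lambda>t. trop_monomial m t z) ` T"
      using S T Max_in fin unfolding trop_represents_def by (metis finite_imageI image_is_empty)+
    then obtain c a d b where st: "(c, a) \<in> S" "(d, b) \<in> T"
      and pq: "p z + q z = trop_monomial m (c, a) z + trop_monomial m (d, b) z"
      by auto
    have "(c + d, \<lambda>i. a i + b i) \<in> R"
      unfolding R_def using st by (intro image_eqI[of _ _ "((c, a), (d, b))"]) auto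
    then show "p z + q z \<in> (\<lambda>r. trop_monomial m r z) ` R"
      by (intro image_eqI) (simp_all add: pq trop_monomial_add)
  qed
  then have "trop_represents m R (\<lambda>z. p z + q z)"
    using fin by (simp add: trop_represents_def R_def)
  then show ?thesis
    by (auto simp: trop_polynomial_def)
qed

lemma trop_rational_polynomial:
  assumes "trop_polynomial m p"
  shows "trop_rational m p"
  unfolding trop_rational_def using assms trop_polynomial_const[of m 0] by force

lemmas trop_rational_const = trop_rational_polynomial[OF trop_polynomial_const]
lemmas trop_rational_coordinate = trop_rational_polynomial[OF trop_polynomial_coordinate]

lemma trop_rational_add:
  assumes "trop_rational m f" and "trop_rational m g"
  shows "trop_rational m (\<lambda>z. f z + g z)"
proof -
  obtain p q p' q' where
    "trop_polynomial m p" "trop_polynomial m q" "\<And>z. f z = p z - q z"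
    "trop_polynomial m p'" "trop_polynomial m q'" "\<And>z. g z = p' z - q' z"
    using assms unfolding trop_rational_def by blast
  then show ?thesis
    unfolding trop_rational_def
    by (intro exI[of _ "\<lambda>z. p z + p' z"] exI[of _ "\<lambda>z. q z + q' z"])
      (simp add: trop_polynomial_add)
qed

lemma trop_rational_diff:
  assumes "trop_rational m f" and "trop_rational m g"
  shows "trop_rational m (\<lambda>z. f z - g z)"
proof -
  have "trop_rational m (\<lambda>z. - g z)"
    using assms(2) unfolding trop_rational_def by (metis minus_diff_eq)
  from trop_rational_add[OF assms(1) this] show ?thesis
    by simp
qed

lemma trop_rational_max:
  assumes "trop_rational m f" and "trop_rational m g"
  shows "trop_rational m (\<lambda>z. max (f z) (g z))"
proof -
  obtain p q p' q' where
    "trop_polynomial m p" "trop_polynomial m q" "\<And>z. f z = p z - q z"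
    "trop_polynomial m p'" "trop_polynomial m q'" "\<And>z. g z = p' z - q' z"
    using assms unfolding trop_rational_def by blast
  moreover have "max (p z - q z) (p' z - q' z) = max (p z + q' z) (p' z + q z) - (q z + q' z)" for z
    by (auto simp: max_def)
  ultimately show ?thesis
    unfolding trop_rational_def
    by (intro exI[of _ "\<lambda>z. max (p z + q' z) (p' z + q z)"] exI[of _ "\<lambda>z. q z + q' z"])
      (simp add: trop_polynomial_add trop_polynomial_max)
qed

lemma trop_rational_sum:
  assumes "\<And>i. i \<in> A \<Longrightarrow> trop_rational m (f i)"
  shows "trop_rational m (\<lambda>z. \<Sum>i\<in>A. f i z)"
  using assms
  by (induction A rule: infinite_finite_induct)
    (auto intro: trop_rational_add trop_rational_const)

lemma trop_rational_scale:
  assumes "trop_rational m f"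
  shows "trop_rational m (\<lambda>z. real n * f z)"
  using trop_rational_sum[of "{..<n}" m "\<lambda>_. f"] assms by simp

lemma trop_rational_Max:
  assumes "finite A" and "A \<noteq> {}" and "\<And>i. i \<in> A \<Longrightarrow> trop_rational m (f i)"
  shows "trop_rational m (\<lambda>z. Max ((\<lambda>i. f i z) ` A))"
  using assms
  by (induction A rule: finite_ne_induct) (auto intro: trop_rational_max)

lemma trop_rational_compose:
  assumes "trop_rational n f" and u: "\<And>i. i \<in> {1..n} \<Longrightarrow> trop_rational m (u i)"
  shows "trop_rational m (\<lambda>z. f (\<lambda>i. u i z))"
proof -
  have poly: "trop_rational m (\<lambda>z. p (\<lambda>i. u i z))" if p: "trop_polynomial n p" for p
  proof -
    obtain T where "trop_represents n T p"
      using p by (auto simp: trop_polynomial_def)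
    then have "finite T" "T \<noteq> {}" and T: "\<And>z. p z = Max ((\<lambda>t. trop_monomial n t z) ` T)"
      by (auto simp: trop_represents_def)
    moreover have "trop_rational m (\<lambda>z. trop_monomial n t (\<lambda>i. u i z))" for t
      unfolding trop_monomial_def
      by (intro trop_rational_add trop_rational_const trop_rational_sum trop_rational_scale u)
    ultimately show ?thesis
      unfolding T by (intro trop_rational_Max)
  qed
  obtain p q where pq: "trop_polynomial n p" "trop_polynomial n q" "\<And>z. f z = p z - q z"
    using assms(1) unfolding trop_rational_def by blast
  then show ?thesis
    using trop_rational_diff[OF poly[OF pq(1)] poly[OF pq(2)]] by (simp add: pq(3))
qed

text \<open>
  A monomial changes by at most its degree times the sup distance, and a maximum of functions
  inherits a common Lipschitz constant.  The constant being a natural number is what later allows it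
  to appear as an exponent.
\<close>

lemma trop_polynomial_Lipschitz:
  assumes "trop_polynomial m p"
  shows "\<exists>L::nat. \<forall>x y \<delta>. (\<forall>i\<in>{1..m}. \<bar>x i - y i\<bar> \<le> \<delta>) \<and> 0 \<le> \<delta> \<longrightarrow> \<bar>p x - p y\<bar> \<le> real L * \<delta>"
proof -
  obtain T where "trop_represents m T p"
    using assms by (auto simp: trop_polynomial_def)
  then have T: "finite T" "T \<noteq> {}" "\<And>z. p z = Max ((\<lambda>t. trop_monomial m t z) ` T)"
    by (auto simp: trop_represents_def)
  define L where "L = Max ((\<lambda>t. \<Sum>i=1..m. snd t i) ` T)"
  have one_sided: "p x \<le> p y + real L * \<delta>"
    if close: "\<And>i. i \<in> {1..m} \<Longrightarrow> \<bar>x i - y i\<bar> \<le> \<delta>" and "0 \<le> \<delta>" for x y \<delta>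
  proof -
    have "trop_monomial m t x \<le> p y + real L * \<delta>" if "t \<in> T" for t
    proof -
      have "(\<Sum>i=1..m. real (snd t i) * x i) \<le> (\<Sum>i=1..m. real (snd t i) * y i + real (snd t i) * \<delta>)"
      proof (rule sum_mono)
        fix i assume "i \<in> {1..m}"
        then have "x i \<le> y i + \<delta>"
          using close[of i] by linarith
        then show "real (snd t i) * x i \<le> real (snd t i) * y i + real (snd t i) * \<delta>"
          by (metis distrib_left mult_left_mono of_nat_0_le_iff)
      qed
      also have "\<dots> = (\<Sum>i=1..m. real (snd t i) * y i) + real (\<Sum>i=1..m. snd t i) * \<delta>"
        by (simp add: sum.distrib sum_distrib_right)
      finally have "trop_monomial m t x \<le> trop_monomial m t y + real (\<Sum>i=1..m. snd t i) * \<delta>"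
        by (simp add: trop_monomial_def)
      moreover have "trop_monomial m t y \<le> p y"
        using T that by simp
      moreover have "(\<Sum>i=1..m. snd t i) \<le> L"
        using T that by (simp add: L_def)
      then have "real (\<Sum>i=1..m. snd t i) * \<delta> \<le> real L * \<delta>"
        using \<open>0 \<le> \<delta>\<close> by (intro mult_right_mono) (simp_all only: of_nat_le_iff)
      ultimately show ?thesis
        by linarith
    qed
    then show ?thesis
      using T by simp
  qed
  have "\<bar>p x - p y\<bar> \<le> real L * \<delta>" if "\<forall>i\<in>{1..m}. \<bar>x i - y i\<bar> \<le> \<delta>" "0 \<le> \<delta>" for x y \<delta>
    using one_sided[of x y \<delta>] one_sided[of y x \<delta>] that by (auto simp: abs_minus_commute abs_le_iff)
  then show ?thesis
    by blast
qed

lemma trop_rational_Lipschitz: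
  assumes "trop_rational m f"
  obtains L :: nat where
    "\<And>x y \<delta>. (\<And>i. i \<in> {1..m} \<Longrightarrow> \<bar>x i - y i\<bar> \<le> \<delta>) \<Longrightarrow> 0 \<le> \<delta> \<Longrightarrow> \<bar>f x - f y\<bar> \<le> real L * \<delta>"
proof -
  obtain p q where pq: "trop_polynomial m p" "trop_polynomial m q" "\<And>z. f z = p z - q z"
    using assms unfolding trop_rational_def by blast
  obtain K L :: nat where
    K: "\<And>x y \<delta>. (\<forall>i\<in>{1..m}. \<bar>x i - y i\<bar> \<le> \<delta>) \<Longrightarrow> 0 \<le> \<delta> \<Longrightarrow> \<bar>p x - p y\<bar> \<le> real K * \<delta>" and
    L: "\<And>x y \<delta>. (\<forall>i\<in>{1..m}. \<bar>x i - y i\<bar> \<le> \<delta>) \<Longrightarrow> 0 \<le> \<delta> \<Longrightarrow> \<bar>q x - q y\<bar> \<le> real L * \<delta>"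
    using trop_polynomial_Lipschitz[OF pq(1)] trop_polynomial_Lipschitz[OF pq(2)] by blast
  show ?thesis
  proof (rule that[of "K + L"])
    fix x y :: "nat \<Rightarrow> real" and \<delta> :: real
    assume "\<And>i. i \<in> {1..m} \<Longrightarrow> \<bar>x i - y i\<bar> \<le> \<delta>" and "0 \<le> \<delta>"
    then have "\<bar>p x - p y\<bar> \<le> real K * \<delta>" "\<bar>q x - q y\<bar> \<le> real L * \<delta>"
      using K L by blast+
    then show "\<bar>f x - f y\<bar> \<le> real (K + L) * \<delta>"
      by (simp add: pq(3) distrib_right)
  qed
qed

section \<open>Maxima of a monomial over a set of permutations\<close>

text \<open>
  For a group \<open>P\<close> this is the maximum over the orbit of the monomial with exponent \<open>a\<close>.  For a coset
  \<open>P = {\<sigma> \<circ> w | \<sigma> \<in> G}\<close> it is the maximum over the \<open>G\<close>-orbit of the monomial with exponent \<open>a \<circ> w\<inverse>\<close>;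
  working with cosets keeps one fixed exponent \<open>a\<close>.
\<close>

definition orbit_max :: "nat \<Rightarrow> (nat \<Rightarrow> nat) set \<Rightarrow> (nat \<Rightarrow> nat) \<Rightarrow> (nat \<Rightarrow> real) \<Rightarrow> real" where
  "orbit_max N P a x = Max ((\<lambda>\<sigma>. \<Sum>i=1..N. real (a i) * x (\<sigma> i)) ` P)"

lemma orbit_max_represents:
  assumes P: "finite P" "P \<noteq> {}" "\<And>\<sigma>. \<sigma> \<in> P \<Longrightarrow> \<sigma> permutes {1..N}"
  shows "trop_represents N ((\<lambda>\<sigma>. (0, a \<circ> inv' \<sigma>)) ` P) (orbit_max N P a)"
proof -
  have "trop_monomial N (0, a \<circ> inv' \<sigma>) x = (\<Sum>i=1..N. real (a i) * x (\<sigma> i))" if "\<sigma> \<in> P" for \<sigma> x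
    using sum.permute[OF P(3)[OF that], of "\<lambda>j. real (a (inv' \<sigma> j)) * x j"] P(3)[OF that]
    by (simp add: trop_monomial_def permutes_inverses comp_def)
  then show ?thesis
    using P by (simp add: trop_represents_def orbit_max_def image_image)
qed

lemma orbit_max_degree:
  assumes P: "finite P" "P \<noteq> {}" "\<And>\<sigma>. \<sigma> \<in> P \<Longrightarrow> \<sigma> permutes {1..N}"
  shows "trop_degree N (orbit_max N P a) \<le> (\<Sum>i=1..N. a i)"
proof -
  have "(\<Sum>i=1..N. a (inv' \<sigma> i)) = (\<Sum>i=1..N. a i)" if "\<sigma> \<in> P" for \<sigma>
    using sum.permute[OF permutes_inv[OF P(3)[OF that]], of a] by (simp add: comp_def)
  then have "(\<lambda>t. \<Sum>i=1..N. snd t i) ` (\<lambda>\<sigma>. (0::real, a \<circ> inv' \<sigma>)) ` P = {\<Sum>i=1..N. a i}"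
    using P(2) by (auto simp: image_image)
  then have "Max ((\<lambda>t. \<Sum>i=1..N. snd t i) ` (\<lambda>\<sigma>. (0::real, a \<circ> inv' \<sigma>)) ` P) = (\<Sum>i=1..N. a i)"
    by simp
  with orbit_max_represents[OF P, of a] show ?thesis
    unfolding trop_degree_def by (intro Least_le) metis
qed

text \<open>
  Left multiplication by \<open>\<tau>\<close> is an injective self-map of the finite set \<open>P\<close>, hence only reorders the
  terms of the maximum.
\<close>

lemma orbit_max_invariant:
  assumes "finite P" and "\<And>\<tau> \<sigma>. \<tau> \<in> H \<Longrightarrow> \<sigma> \<in> P \<Longrightarrow> \<tau> \<circ> \<sigma> \<in> P" and "\<And>\<tau>. \<tau> \<in> H \<Longrightarrow> inj \<tau>"
  shows "perm_invariant H (orbit_max N P a)"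
  unfolding perm_invariant_def
proof (intro ballI allI)
  fix \<tau> x assume \<tau>: "\<tau> \<in> H"
  have "inj_on ((\<circ>) \<tau>) P"
    using assms(3)[OF \<tau>] by (auto simp: inj_on_def fun_eq_iff)
  then have "(\<circ>) \<tau> ` P = P"
    using assms(1,2) \<tau> by (intro endo_inj_surj) auto
  then have "(\<lambda>\<sigma>. \<Sum>i=1..N. real (a i) * x (\<sigma> i)) ` (\<circ>) \<tau> ` P
      = (\<lambda>\<sigma>. \<Sum>i=1..N. real (a i) * x (\<sigma> i)) ` P"
    by simp
  then show "orbit_max N P a (x \<circ> \<tau>) = orbit_max N P a x"
    by (simp add: orbit_max_def image_image comp_def)
qed

section \<open>Sorting and the staircase exponent\<close>

text \<open>
  After subtracting the threshold \<open>t k\<close> from every term, the indices up to \<open>k\<close> contribute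
  nonnegative terms and all others nonpositive ones; as \<open>A\<close> has \<open>k\<close> elements, both sides change by
  the same amount.
\<close>

lemma sum_le_sum_of_largest:
  fixes t :: "nat \<Rightarrow> real"
  assumes t: "antimono_on {1..N} t" and "k \<le> N" and A: "A \<subseteq> {1..N}" "card A = k"
  shows "(\<Sum>i\<in>A. t i) \<le> (\<Sum>i=1..k. t i)"
proof (cases "k = 0")
  case True
  then have "A = {}"
    using A finite_subset by fastforce
  then show ?thesis
    using True by simp
next
  case False
  have fin: "finite A"
    using A finite_subset by blast
  have "(\<Sum>i\<in>A. t i - t k) \<le> (\<Sum>i\<in>A \<inter> {1..k}. t i - t k)"
  proof -
    have "(\<Sum>i\<in>A - {1..k}. t i - t k) \<le> 0"
      using A False \<open>k \<le> N\<close> by (intro sum_nonpos) (auto intro!: monotone_onD[OF t])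
    then show ?thesis
      using sum.Int_Diff[OF fin, of "\<lambda>i. t i - t k" "{1..k}"] by simp
  qed
  also have "\<dots> \<le> (\<Sum>i=1..k. t i - t k)"
    using False \<open>k \<le> N\<close> by (intro sum_mono2) (auto intro!: monotone_onD[OF t])
  finally show ?thesis
    using A by (simp add: sum_subtractf)
qed

lemma sorting_permutation:
  fixes x :: "nat \<Rightarrow> real"
  obtains \<pi> where "\<pi> permutes {1..N}" and "antimono_on {1..N} (x \<circ> \<pi>)"
proof -
  define xs where "xs = sort_key (\<lambda>i. - x i) [1..<Suc N]"
  define \<pi> where "\<pi> i = (if i \<in> {1..N} then xs ! (i - 1) else i)" for i
  have xs: "length xs = N" "distinct xs" "set xs = {1..N}"
    by (auto simp: xs_def)
  have "bij_betw ((!) xs \<circ> (\<lambda>i. i - 1)) {1..N} {1..N}"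
  proof (rule bij_betw_trans)
    show "bij_betw (\<lambda>i. i - 1) {1..N} {..<N}"
      by (rule bij_betw_byWitness[where f' = Suc]) auto
    show "bij_betw ((!) xs) {..<N} {1..N}"
      using xs by (intro bij_betw_nth) auto
  qed
  moreover have "bij_betw \<pi> {1..N} {1..N} \<longleftrightarrow> bij_betw ((!) xs \<circ> (\<lambda>i. i - 1)) {1..N} {1..N}"
    by (rule bij_betw_cong) (simp add: \<pi>_def)
  ultimately have "bij_betw \<pi> {1..N} {1..N}"
    by blast
  then have "\<pi> permutes {1..N}"
    by (rule bij_imp_permutes) (simp only: \<pi>_def if_False)
  moreover have "antimono_on {1..N} (x \<circ> \<pi>)"
  proof (rule monotone_onI)
    fix i j assume "i \<in> {1..N}" "j \<in> {1..N}" "i \<le> j"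
    moreover have "sorted (map (\<lambda>i. - x i) xs)"
      by (simp add: xs_def)
    ultimately have "map (\<lambda>i. - x i) xs ! (i - 1) \<le> map (\<lambda>i. - x i) xs ! (j - 1)"
      using xs by (intro sorted_nth_mono) auto
    moreover have "i - 1 < N" "j - 1 < N"
      using \<open>i \<in> _\<close> \<open>j \<in> _\<close> by auto
    ultimately show "(x \<circ> \<pi>) j \<le> (x \<circ> \<pi>) i"
      using \<open>i \<in> _\<close> \<open>j \<in> _\<close> xs(1) by (simp add: \<pi>_def)
  qed
  ultimately show ?thesis
    by (rule that)
qed

text \<open>
  The weight \<open>N - i\<close> counts the partial sums of length at most \<open>N - 1\<close> that contain \<open>t i\<close>.
\<close>

lemma staircase_summation:
  fixes t :: "nat \<Rightarrow> real"
  shows "(\<Sum>i=1..N. real (N - i) * t i) = (\<Sum>k=1..N-1. \<Sum>i=1..k. t i)"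
proof (induction N)
  case (Suc N)
  have "(\<Sum>i=1..Suc N. real (Suc N - i) * t i) = (\<Sum>i=1..N. real (N - i) * t i + t i)"
    by (simp add: Suc_diff_le algebra_simps)
  also have "\<dots> = (\<Sum>k=1..N. \<Sum>i=1..k. t i)"
    using Suc.IH by (cases N) (simp_all add: sum.distrib)
  finally show ?case
    by simp
qed simp

text \<open>
  This makes the rearrangement inequality quantitative.  By summation by parts the right-hand side is
  \<open>P 1 + \<dots> + P (N - 1)\<close>, where \<open>P k\<close> is the excess of the partial sum of \<open>t\<close> over that of \<open>t \<circ> \<tau>\<close>.
  All \<open>P k\<close> are nonnegative because \<open>t\<close> is sorted, and \<open>t j - t (\<tau> j)\<close> is the difference of the two
  consecutive terms \<open>P j\<close> and \<open>P (j - 1)\<close>, each between 0 and the whole sum.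
\<close>

lemma staircase_gap:
  fixes t :: "nat \<Rightarrow> real"
  assumes t: "antimono_on {1..N} t" and \<tau>: "\<tau> permutes {1..N}" and "j \<in> {1..N}"
  shows "\<bar>t j - t (\<tau> j)\<bar> \<le> (\<Sum>i=1..N. real (N - i) * t i) - (\<Sum>i=1..N. real (N - i) * t (\<tau> i))"
proof -
  define P where "P k = (\<Sum>i=1..k. t i - t (\<tau> i))" for k
  have P_nonneg: "0 \<le> P k" if "k \<le> N" for k
  proof -
    have "(\<Sum>i=1..k. t (\<tau> i)) = (\<Sum>i\<in>\<tau> ` {1..k}. t i)"
      using permutes_inj_on[OF \<tau>] by (simp add: sum.reindex)
    also have "\<dots> \<le> (\<Sum>i=1..k. t i)"
      using that permutes_image[OF \<tau>] permutes_inj_on[OF \<tau>]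
      by (intro sum_le_sum_of_largest[OF t that]) (auto simp: card_image)
    finally show ?thesis
      by (simp add: P_def sum_subtractf)
  qed
  have "P N = 0"
    using sum.permute[OF \<tau>, of t] by (simp add: P_def sum_subtractf comp_def)
  have P_le: "P k \<le> (\<Sum>k=1..N-1. P k)" if "k \<le> N" for k
  proof (cases "k \<in> {1..N-1}")
    case True
    then show ?thesis
      using P_nonneg by (intro member_le_sum) auto
  next
    case False
    then have "k = 0 \<or> k = N"
      using that by auto
    then have "P k = 0"
      using \<open>P N = 0\<close> by (auto simp: P_def)
    then show ?thesis
      using P_nonneg by (auto intro!: sum_nonneg)
  qed
  obtain i where j: "j = Suc i"
    using \<open>j \<in> _\<close> by (cases j) auto
  have "t j - t (\<tau> j) = P j - P i"
    by (simp add: P_def j)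
  moreover have "(\<Sum>i=1..N. real (N - i) * t i) - (\<Sum>i=1..N. real (N - i) * t (\<tau> i)) = (\<Sum>k=1..N-1. P k)"
    by (simp only: staircase_summation P_def sum_subtractf)
  ultimately show ?thesis
    using P_le[of i] P_le[of j] P_nonneg[of i] P_nonneg[of j] \<open>j \<in> _\<close> j by auto
qed

section \<open>Reconstruction of invariants from the generators\<close>

abbreviation trop_elementary :: "nat \<Rightarrow> nat \<Rightarrow> (nat \<Rightarrow> real) \<Rightarrow> real" where
  "trop_elementary N k \<equiv> orbit_max N {\<pi>. \<pi> permutes {1..N}} (\<lambda>i. if i \<le> k then 1 else 0)"

abbreviation staircase_max ::
  "nat \<Rightarrow> (nat \<Rightarrow> nat) set \<Rightarrow> (nat \<Rightarrow> nat) \<Rightarrow> (nat \<Rightarrow> real) \<Rightarrow> real" where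
  "staircase_max N G w \<equiv> orbit_max N ((\<lambda>\<sigma>. \<sigma> \<circ> w) ` G) (\<lambda>i. N - i)"

text \<open>
  So the differences of consecutive elementary polynomials are the sorted coordinates.
\<close>

lemma trop_elementary_sorted:
  assumes \<pi>: "\<pi> permutes {1..N}" and sorted: "antimono_on {1..N} (x \<circ> \<pi>)" and "k \<le> N"
  shows "trop_elementary N k x = (\<Sum>i=1..k. x (\<pi> i))"
proof -
  have cut: "(\<Sum>i=1..N. real (if i \<le> k then 1 else 0) * x (\<sigma> i)) = (\<Sum>i=1..k. x (\<sigma> i))" for \<sigma>
  proof -
    have "{1..N} \<inter> {i. i \<le> k} = {1..k}"
      using \<open>k \<le> N\<close> by auto
    then show ?thesis
      using sum.inter_restrict[of "{1..N}" "\<lambda>i. x (\<sigma> i)" "{i. i \<le> k}"]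
      by (simp add: if_distrib[of real] if_distrib[of "\<lambda>a. a * _"] cong: if_cong)
  qed
  have "(\<Sum>i=1..k. x (\<sigma> i)) \<le> (\<Sum>i=1..k. x (\<pi> i))" if \<sigma>: "\<sigma> permutes {1..N}" for \<sigma>
  proof -
    define \<tau> where "\<tau> = inv' \<pi> \<circ> \<sigma>"
    have \<tau>: "\<tau> permutes {1..N}"
      unfolding \<tau>_def by (intro permutes_compose permutes_inv \<pi> \<sigma>)
    have "(\<Sum>i=1..k. x (\<sigma> i)) = (\<Sum>i=1..k. (x \<circ> \<pi>) (\<tau> i))"
      using permutes_inverses[OF \<pi>] by (simp add: \<tau>_def)
    also have "\<dots> = (\<Sum>i\<in>\<tau> ` {1..k}. (x \<circ> \<pi>) i)"
      using permutes_inj_on[OF \<tau>] by (simp add: sum.reindex)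
    also have "\<dots> \<le> (\<Sum>i=1..k. (x \<circ> \<pi>) i)"
      using \<open>k \<le> N\<close> permutes_image[OF \<tau>] permutes_inj_on[OF \<tau>]
      by (intro sum_le_sum_of_largest[OF sorted]) (auto simp: card_image)
    finally show ?thesis
      by simp
  qed
  then show ?thesis
    unfolding orbit_max_def cut using \<pi>
    by (intro Max_eqI) (auto simp: finite_permutations)
qed

text \<open>
  The function \<open>t x\<close> is the decreasing rearrangement of \<open>x\<close>.  The term of \<open>w\<close> guesses that
  \<open>t x \<circ> w\<inverse>\<close> lies in the orbit of \<open>x\<close> and penalises the guess by \<open>L\<close> times its error, measured by the
  staircase gap.  By \<open>staircase_gap\<close> that error bounds the distance to the orbit, so no guess exceeds
  \<open>f x\<close>, and a permutation that sorts \<open>x\<close> is a guess without error.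
\<close>

lemma invariant_reconstruction:
  assumes G: "subgroup G (sym_group N)" and f: "trop_rational N f" "perm_invariant G f"
    and L: "\<And>x y \<delta>. (\<And>i. i \<in> {1..N} \<Longrightarrow> \<bar>x i - y i\<bar> \<le> \<delta>) \<Longrightarrow> 0 \<le> \<delta> \<Longrightarrow> \<bar>f x - f y\<bar> \<le> real L * \<delta>"
  defines "t \<equiv> \<lambda>x k. trop_elementary N k x - trop_elementary N (k - 1) x"
  shows "f x = Max ((\<lambda>w. f (t x \<circ> inv' w)
           - real L * ((\<Sum>k=1..N-1. trop_elementary N k x) - staircase_max N G w x))
         ` {w. w permutes {1..N}})"
proof -
  have G_permutes: "\<sigma> permutes {1..N}" if "\<sigma> \<in> G" for \<sigma>
    using subgroup.mem_carrier[OF G that] by (simp add: sym_group_carrier)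
  have "finite G"
    using G_permutes finite_permutations[of "{1..N}"] by (auto intro: finite_subset[of G "{\<pi>. \<pi> permutes {1..N}}"])
  have "id \<in> G"
    using subgroup.one_closed[OF G] by (simp add: sym_group_def)
  obtain \<pi> where \<pi>: "\<pi> permutes {1..N}" and sorted: "antimono_on {1..N} (x \<circ> \<pi>)"
    by (rule sorting_permutation)
  have elem: "trop_elementary N k x = (\<Sum>i=1..k. x (\<pi> i))" if "k \<le> N" for k
    by (rule trop_elementary_sorted[OF \<pi> sorted that])
  have t: "t x i = x (\<pi> i)" if "i \<in> {1..N}" for i
    using that elem[of i] elem[of "i - 1"] by (cases i) (simp_all add: t_def)
  define E where "E = (\<Sum>k=1..N-1. trop_elementary N k x)"
  have E: "E = (\<Sum>i=1..N. real (N - i) * x (\<pi> i))"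
    unfolding E_def staircase_summation by (intro sum.cong refl elem) auto
  have f_t: "f (t x \<circ> inv' w) = f (x \<circ> \<pi> \<circ> inv' w)" if "w permutes {1..N}" for w
  proof (rule trop_rational_cong[OF f(1)])
    fix i assume "1 \<le> i" "i \<le> N"
    then have "inv' w i \<in> {1..N}"
      using permutes_in_image[OF permutes_inv[OF that]] by auto
    then show "(t x \<circ> inv' w) i = (x \<circ> \<pi> \<circ> inv' w) i"
      by (simp add: t)
  qed
  have le: "f (t x \<circ> inv' w) - real L * (E - staircase_max N G w x) \<le> f x"
    if w: "w permutes {1..N}" for w
  proof -
    have "staircase_max N G w x \<in> (\<lambda>\<sigma>. \<Sum>i=1..N. real (N - i) * x (\<sigma> i)) ` (\<lambda>\<sigma>. \<sigma> \<circ> w) ` G"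
      unfolding orbit_max_def using \<open>finite G\<close> \<open>id \<in> G\<close> by (intro Max_in) auto
    then obtain \<sigma> where "\<sigma> \<in> G" and
      \<sigma>: "staircase_max N G w x = (\<Sum>i=1..N. real (N - i) * x (\<sigma> (w i)))"
      by auto
    \<comment> \<open>\<open>x \<circ> \<sigma>\<close> is the point of the orbit that is compared with \<open>t x \<circ> w\<inverse>\<close>.\<close>
    define \<delta> where "\<delta> = E - staircase_max N G w x"
    define \<tau> where "\<tau> = inv' \<pi> \<circ> (\<sigma> \<circ> w)"
    have \<tau>: "\<tau> permutes {1..N}"
      unfolding \<tau>_def by (intro permutes_compose permutes_inv \<pi> w G_permutes \<open>\<sigma> \<in> G\<close>)
    have \<pi>\<tau>: "\<pi> (\<tau> i) = \<sigma> (w i)" for i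
      using permutes_inverses[OF \<pi>] by (simp add: \<tau>_def)
    have gap: "\<bar>x (\<pi> i) - x (\<sigma> (w i))\<bar> \<le> \<delta>" if "i \<in> {1..N}" for i
      using staircase_gap[OF sorted \<tau> that] by (simp add: \<delta>_def E \<sigma> \<pi>\<tau>)
    have "\<bar>f (x \<circ> \<pi> \<circ> inv' w) - f (x \<circ> \<sigma>)\<bar> \<le> real L * \<delta>"
    proof (rule L)
      fix i assume "i \<in> {1..N}"
      then have "inv' w i \<in> {1..N}"
        using permutes_in_image[OF permutes_inv[OF w]] by auto
      from gap[OF this] show "\<bar>(x \<circ> \<pi> \<circ> inv' w) i - (x \<circ> \<sigma>) i\<bar> \<le> \<delta>"
        by (simp add: permutes_inverses[OF w])
    next
      show "0 \<le> \<delta>"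
      proof (cases "N = 0")
        case True
        then show ?thesis
          unfolding \<delta>_def E \<sigma> by simp
      next
        case False
        then show ?thesis
          using gap[of 1] by simp
      qed
    qed
    moreover have "f (x \<circ> \<sigma>) = f x"
      using f(2) \<open>\<sigma> \<in> G\<close> by (simp add: perm_invariant_def)
    ultimately show ?thesis
      by (simp add: f_t[OF w] \<delta>_def)
  qed
  \<comment> \<open>The identity in \<open>G\<close> shows that the term of the sorting permutation \<open>\<pi>\<close> carries no penalty.\<close>
  have "staircase_max N G \<pi> x \<ge> (\<Sum>i=1..N. real (N - i) * x ((id \<circ> \<pi>) i))"
    unfolding orbit_max_def using \<open>finite G\<close> \<open>id \<in> G\<close> by (intro Max_ge) blast+
  then have "E - staircase_max N G \<pi> x \<le> 0"
    by (simp add: E)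
  then have "real L * (E - staircase_max N G \<pi> x) \<le> 0"
    by (simp add: mult_nonneg_nonpos)
  moreover have "x \<circ> \<pi> \<circ> inv' \<pi> = x"
    using permutes_inv_o[OF \<pi>] by (simp add: comp_assoc)
  ultimately have "f (t x \<circ> inv' \<pi>) - real L * (E - staircase_max N G \<pi> x) = f x"
    using le[OF \<pi>] f_t[OF \<pi>] by simp
  then show ?thesis
    unfolding E_def[symmetric] using le \<pi>
    by (intro sym[OF Max_eqI]) (force simp: finite_permutations)+
qed

theorem corollary4p2:
  fixes N :: nat and G :: "(nat \<Rightarrow> nat) set"
  assumes "N > 0"
    and "subgroup G (sym_group N)"
  shows "\<exists>(k::nat) (fs :: nat \<Rightarrow> (nat \<Rightarrow> real) \<Rightarrow> real).
           (\<forall>i\<in>{1..k}. trop_polynomial N (fs i) \<and> perm_invariant G (fs i) \<and>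
              trop_degree N (fs i) \<le> max N (N choose 2)) \<and>
           generates_invariant_semifield N G k fs"
proof -
  define S where "S = {w. w permutes {1..N}}"
  have "finite S"
    by (simp add: S_def finite_permutations)
  have "id \<in> S"
    by (simp add: S_def permutes_id)
  have "G \<subseteq> S"
    using subgroup.subset[OF assms(2)] by (simp add: S_def sym_group_def)
  have "finite G"
    using \<open>G \<subseteq> S\<close> \<open>finite S\<close> finite_subset by blast
  have "G \<noteq> {}"
    using subgroup.one_closed[OF assms(2)] by blast
  have G_closed: "\<tau> \<circ> \<sigma> \<in> G" if "\<tau> \<in> G" "\<sigma> \<in> G" for \<tau> \<sigma>
    using subgroup.m_closed[OF assms(2) that] by (simp add: sym_group_def)
  have inj: "inj \<tau>" if "\<tau> \<in> G" for \<tau>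
    using that \<open>G \<subseteq> S\<close> permutes_inj by (auto simp: S_def)
  have generator: "trop_polynomial N h \<and> perm_invariant G h \<and> trop_degree N h \<le> max N (N choose 2)"
    if h: "h = orbit_max N P a" and P: "P \<subseteq> S" "P \<noteq> {}"
      and closed: "\<And>\<tau> \<sigma>. \<tau> \<in> G \<Longrightarrow> \<sigma> \<in> P \<Longrightarrow> \<tau> \<circ> \<sigma> \<in> P"
      and a: "(\<Sum>i=1..N. a i) \<le> max N (N choose 2)" for h P a
  proof -
    have "finite P" and perm: "\<And>\<sigma>. \<sigma> \<in> P \<Longrightarrow> \<sigma> permutes {1..N}"
      using P \<open>finite S\<close> finite_subset by (auto simp: S_def)
    then show ?thesis
      using orbit_max_represents[OF \<open>finite P\<close> P(2) perm, of a]
        orbit_max_degree[OF \<open>finite P\<close> P(2) perm, of a]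
        orbit_max_invariant[OF \<open>finite P\<close> closed inj, where N = N and a = a] a
      by (auto simp: h trop_polynomial_def)
  qed
  have elementary: "trop_polynomial N (trop_elementary N j) \<and> perm_invariant G (trop_elementary N j) \<and>
      trop_degree N (trop_elementary N j) \<le> max N (N choose 2)" for j
  proof (rule generator[OF refl])
    have "(\<Sum>i=1..N. if i \<le> j then 1 else 0) \<le> (\<Sum>i=1..N. 1::nat)"
      by (intro sum_mono) auto
    then show "(\<Sum>i=1..N. if i \<le> j then 1 else 0) \<le> max N (N choose 2)"
      by simp
    show "\<tau> \<circ> \<sigma> \<in> {\<pi>. \<pi> permutes {1..N}}" if "\<tau> \<in> G" "\<sigma> \<in> {\<pi>. \<pi> permutes {1..N}}" for \<tau> \<sigma>
      using that \<open>G \<subseteq> S\<close> by (auto simp: S_def intro: permutes_compose)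
  qed (use \<open>id \<in> S\<close> in \<open>unfold S_def, blast+\<close>)
  have staircase: "trop_polynomial N (staircase_max N G w) \<and> perm_invariant G (staircase_max N G w) \<and>
      trop_degree N (staircase_max N G w) \<le> max N (N choose 2)" if "w \<in> S" for w
  proof (rule generator[OF refl])
    have "(\<Sum>i=1..N. N - i) = (\<Sum>i<N. i)"
      by (rule sum.reindex_bij_witness[of _ "\<lambda>i. N - i" "\<lambda>i. N - i"]) auto
    also have "\<dots> = N choose 2"
      by (cases N) (simp_all add: lessThan_Suc_atMost gauss_sum_nat choose_two atLeast0AtMost[symmetric] mult.commute)
    finally show "(\<Sum>i=1..N. N - i) \<le> max N (N choose 2)"
      by simp
    show "(\<lambda>\<sigma>. \<sigma> \<circ> w) ` G \<subseteq> S"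
      using that \<open>G \<subseteq> S\<close> by (auto simp: S_def intro: permutes_compose)
    show "\<tau> \<circ> \<sigma> \<in> (\<lambda>\<sigma>. \<sigma> \<circ> w) ` G" if "\<tau> \<in> G" "\<sigma> \<in> (\<lambda>\<sigma>. \<sigma> \<circ> w) ` G" for \<tau> \<sigma>
      using that G_closed by (auto simp flip: comp_assoc)
  qed (use \<open>G \<noteq> {}\<close> in auto)
  obtain ws where ws: "set ws = S"
    using finite_list[OF \<open>finite S\<close>] by blast
  define k where "k = N + length ws"
  define fs where "fs i = (if i \<le> N then trop_elementary N i else staircase_max N G (ws ! (i - Suc N)))" for i
  have "generates_invariant_semifield N G k fs"
    unfolding generates_invariant_semifield_def
  proof (intro allI impI)
    fix f assume f: "trop_rational N f \<and> perm_invariant G f"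
    then obtain L :: nat where
      L: "\<And>x y \<delta>. (\<And>i. i \<in> {1..N} \<Longrightarrow> \<bar>x i - y i\<bar> \<le> \<delta>) \<Longrightarrow> 0 \<le> \<delta> \<Longrightarrow> \<bar>f x - f y\<bar> \<le> real L * \<delta>"
      using trop_rational_Lipschitz by blast
    \<comment> \<open>\<open>s i\<close> recovers the \<open>i\<close>-th largest coordinate; \<open>e(0) = 0\<close> is not among the generators, hence
      the separate case \<open>i = 1\<close>.\<close>
    define s where "s i = (\<lambda>z :: nat \<Rightarrow> real. z i - (if i = 1 then 0 else z (i - 1)))" for i
    define g where "g z = Max ((\<lambda>j. f (\<lambda>i. s (inv' (ws ! j) i) z)
      - real L * ((\<Sum>i=1..N-1. z i) - z (Suc N + j))) ` {..<length ws})" for z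
    have s_rational: "trop_rational k (s i)" if "i \<in> {1..N}" for i
    proof (cases "i = 1")
      case True
      then show ?thesis
        using that trop_rational_coordinate[of 1 k] by (simp add: s_def k_def)
    next
      case False
      then have "i \<in> {1..k}" "i - 1 \<in> {1..k}"
        using that by (auto simp: k_def)
      from trop_rational_diff[OF this[THEN trop_rational_coordinate]] show ?thesis
        using False by (simp add: s_def)
    qed
    have "trop_rational k g"
      unfolding g_def
    proof (rule trop_rational_Max)
      show "{..<length ws} \<noteq> {}"
        using ws \<open>id \<in> S\<close> by (auto simp: lessThan_empty_iff)
      fix j assume j: "j \<in> {..<length ws}"
      then have w: "ws ! j permutes {1..N}"
        using ws nth_mem[of j ws] by (auto simp: S_def)
      show "trop_rational k (\<lambda>z. f (\<lambda>i. s (inv' (ws ! j) i) z)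
          - real L * ((\<Sum>i=1..N-1. z i) - z (Suc N + j)))"
      proof (intro trop_rational_diff trop_rational_scale trop_rational_sum)
        show "trop_rational k (\<lambda>z. f (\<lambda>i. s (inv' (ws ! j) i) z))"
        proof (rule trop_rational_compose[where n = N and f = f and u = "\<lambda>i. s (inv' (ws ! j) i)"])
          show "trop_rational N f"
            using f ..
          show "trop_rational k (s (inv' (ws ! j) i))" if "i \<in> {1..N}" for i
            using that permutes_in_image[OF permutes_inv[OF w]] by (intro s_rational) blast
        qed
      qed (use j in \<open>auto simp: k_def intro!: trop_rational_coordinate\<close>)
    qed simp
    moreover have "f x = g (\<lambda>i. fs i x)" for x
    proof -
      have zero: "trop_elementary N 0 x = 0"
      proof -
        obtain \<pi> where "\<pi> permutes {1..N}" "antimono_on {1..N} (x \<circ> \<pi>)"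
          by (rule sorting_permutation)
        from trop_elementary_sorted[OF this, of 0] show ?thesis
          by simp
      qed
      define r where "r w = f ((\<lambda>i. trop_elementary N i x - trop_elementary N (i - 1) x) \<circ> inv' w)
        - real L * ((\<Sum>i=1..N-1. trop_elementary N i x) - staircase_max N G w x)" for w
      have "f x = Max (r ` S)"
        unfolding r_def S_def using f by (intro invariant_reconstruction assms(2) L) auto
      also have "r ` S = (\<lambda>j. r (ws ! j)) ` {..<length ws}"
        unfolding ws[symmetric] set_conv_nth by auto
      also have "Max \<dots> = g (\<lambda>i. fs i x)"
        unfolding g_def
      proof (intro arg_cong[of _ _ Max] image_cong refl)
        fix j assume j: "j \<in> {..<length ws}"
        then have w: "ws ! j permutes {1..N}"
          using ws nth_mem[of j ws] by (auto simp: S_def)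
        have "f ((\<lambda>i. trop_elementary N i x - trop_elementary N (i - 1) x) \<circ> inv' (ws ! j))
            = f (\<lambda>i. s (inv' (ws ! j) i) (\<lambda>i. fs i x))"
        proof (rule trop_rational_cong[OF conjunct1[OF f]])
          fix i assume "1 \<le> i" "i \<le> N"
          then have "inv' (ws ! j) i \<in> {1..N}"
            using permutes_in_image[OF permutes_inv[OF w]] by auto
          then show "((\<lambda>i. trop_elementary N i x - trop_elementary N (i - 1) x) \<circ> inv' (ws ! j)) i
              = s (inv' (ws ! j) i) (\<lambda>i. fs i x)"
            using zero by (auto simp: s_def fs_def)
        qed
        moreover have "(\<Sum>i=1..N-1. trop_elementary N i x) = (\<Sum>i=1..N-1. fs i x)"
          by (intro sum.cong) (auto simp: fs_def)
        moreover have "staircase_max N G (ws ! j) x = fs (Suc N + j) x"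
          by (simp add: fs_def)
        ultimately show "r (ws ! j) = f (\<lambda>i. s (inv' (ws ! j) i) (\<lambda>i. fs i x))
            - real L * ((\<Sum>i=1..N-1. fs i x) - fs (Suc N + j) x)"
          by (simp only: r_def)
      qed
      finally show ?thesis .
    qed
    ultimately show "\<exists>g. trop_rational k g \<and> (\<forall>x. f x = g (\<lambda>i. fs i x))"
      by blast
  qed
  moreover have "trop_polynomial N (fs i) \<and> perm_invariant G (fs i) \<and>
      trop_degree N (fs i) \<le> max N (N choose 2)" if "i \<in> {1..k}" for i
  proof (cases "i \<le> N")
    case True
    then show ?thesis
      using elementary by (simp add: fs_def)
  next
    case False
    then have "ws ! (i - Suc N) \<in> S"
      using that ws by (auto simp: k_def)
    then show ?thesis
      using False staircase by (simp add: fs_def)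
  qed
  ultimately show ?thesis
    by blast
qed

end
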